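(* Let $\mathcal{H}$ be a real Hilbert space. For every $k\in\mathbb{N}$ let $G_k:\mathcal{H}\to\mathcal{H}$ be nonexpansive and let $F_k:\mathcal{H}\to\mathcal{H}$ be an operator. Let $(e_k)_{k\in\mathbb{N}}$ be a sequence in $\mathcal{H}$ with $\sum_{k\in\mathbb{N}}\|e_k\|<\infty$. Let $x_0\in\mathcal{H}$ and define $$(\forall k\in\mathbb{N})\quad x_{k+1}=F_kx_k+e_k,$$ $$(\forall k\in\mathbb{N})(\forall i\in\mathbb{N})\quad \xi_{k+1}(i)=G_{k+i}\,\xi_k(i)\quad\text{and}\quad \xi_0(i)=x_i .$$ Then the following hold. (i) Suppose that $\bigcap_{k\in\mathbb{N}}\operatorname{Fix}G_k\neq\varnothing$. Let $\bar x\in\bigcap_{k\in\mathbb{N}}\operatorname{Fix}G_k$ and let $(\gamma_k)_{k\in\mathbb{N}}$ be in $\mathbb{R}_+$ with $\sum_{k\in\mathbb{N}}\gamma_k<\infty$. Suppose that $\sum_{k\in\mathbb{N}}\|F_k\bar x-G_k\bar x\|<\infty$ and that for every $k\in\mathbb{N}$ the operator $F_k$ is $(1+\gamma_k)$-Lipschitz continuous, i.e. $\|F_kx-F_ky\|\le(1+\gamma_k)\|x-y\|$ for all $x,y\in\mathcal{H}$. Then $(\|x_k-\bar x\|)_{k\in\mathbb{N}}$ converges to a point in $\mathbb{R}_+$ and $(x_k)_{k\in\mathbb{N}}$ is bounded. (ii) Suppose that $\sum_{k\in\mathbb{N}}\|F_kx_k-G_kx_k\|<\infty$ and that for every $i\in\mathbb{N}$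 the sequence $(\xi_k(i))_{k\in\mathbb{N}}$ converges weakly to a point $\xi(i)\in\mathcal{H}$. Then: (a) there exists a point $\bar\xi\in\mathcal{H}$ such that $(\xi(i))_{i\in\mathbb{N}}$ converges strongly to $\bar\xi$; (b) $(x_k)_{k\in\mathbb{N}}$ converges weakly to $\bar\xi=\lim_{i\to\infty}\xi(i)$; (c) if, further, for every $i\in\mathbb{N}$ the sequence $(\xi_k(i))_{k\in\mathbb{N}}$ converges strongly to a point $\xi(i)\in\mathcal{H}$, then $(x_k)_{k\in\mathbb{N}}$ converges strongly to $\bar\xi=\lim_{i\to\infty}\xi(i)$.
   Context: $\mathbb{N}=\{0,1,2,\ldots\}$, $\mathbb{R}_+=[0,\infty)$. An operator $G:\mathcal{H}\to\mathcal{H}$ is nonexpansive if $\|Gx-Gy\|\le\|x-y\|$ for all $x,y\in\mathcal{H}$; $\operatorname{Fix}G=\{x\in\mathcal{H}: Gx=x\}$. Strong convergence means convergence in norm. *)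

theory Defs
  imports "HOL-Analysis.Analysis"
begin

definition nonexpansive :: "('a::real_normed_vector \<Rightarrow> 'a) \<Rightarrow> bool" where
  "nonexpansive G \<longleftrightarrow> (\<forall>x y. norm (G x - G y) \<le> norm (x - y))"

definition Fix :: "('a \<Rightarrow> 'a) \<Rightarrow> 'a set" where
  "Fix G = {x. G x = x}"

text \<open>
  Weak convergence of sequences in an inner product space. In a Hilbert space every
  continuous linear functional has the form \<open>\<lambda>v. v \<bullet> u\<close>, so there this is
  convergence in the weak topology.
\<close>

definition weakly_converges_to :: "(nat \<Rightarrow> 'a::real_inner) \<Rightarrow> 'a \<Rightarrow> bool" where
  "weakly_converges_to X l \<longleftrightarrow> (\<forall>u. (\<lambda>k. X k \<bullet> u) \<longlonglongrightarrow> l \<bullet> u)"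

end

theory Submission
  imports Defs
begin

text \<open>
  Both parts regard \<open>x\<close> as a perturbation, with summable errors, of the exact iteration of the
  operators \<open>G k\<close>.

  For the first part, the distance \<open>a k = norm (x k - xbar)\<close> to a common fixed point satisfies
  \<open>a (k + 1) \<le> (1 + \<gamma> k) * a k + \<epsilon> k\<close> with summable \<open>\<gamma>\<close> and \<open>\<epsilon>\<close>. Dividing by the convergent
  product of the factors \<open>1 + \<gamma> k\<close> leaves a sequence that is decreasing up to a summable error
  (\<open>convergent_of_summable_perturbation\<close>).

  For the second part, put \<open>\<delta> k = norm (F k (x k) - G k (x k)) + norm (e k)\<close>, a bound on
  the error of step \<open>k\<close>. Since nonexpansive maps do not amplify errors, the exact iteration
  that starts from \<open>x i\<close> at time \<open>i\<close> stays for ever within the tail sum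
  \<open>r i = (\<Sum>j. \<delta> (j + i))\<close> of \<open>x\<close> (\<open>norm_diff_exact_iteration_le\<close>). Tails of a convergent
  series vanish, so the exact iterations, regarded as sequences in absolute time, converge to \<open>x\<close>
  uniformly in time. The assertions then amount to an exchange of limits: any two
  exact iterations stay within \<open>r i + r j\<close> of each other, hence so do their weak limits, as the
  norm is weakly lower semicontinuous; the limits form a Cauchy sequence, and the uniform
  approximation carries its limit over to \<open>x\<close> (\<open>exchange_weak_limits\<close>).
\<close>

text \<open>
  With the partial products \<open>P n = (\<Prod>k<n. 1 + \<gamma> k) \<ge> 1\<close>, the quotient \<open>b n = a n / P n\<close>
  satisfies \<open>b (n + 1) \<le> b n + \<epsilon> n\<close>. Hence \<open>b n - (\<Sum>k<n. \<epsilon> k)\<close> is decreasing and bounded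
  below, and the convergence of \<open>P\<close> transfers that of \<open>b\<close> back to \<open>a\<close>.
\<close>

lemma convergent_of_summable_perturbation:
  fixes a \<gamma> \<epsilon> :: "nat \<Rightarrow> real"
  assumes a_nonneg: "\<And>k. 0 \<le> a k"
    and \<gamma>_nonneg: "\<And>k. 0 \<le> \<gamma> k" and \<gamma>_summable: "summable \<gamma>"
    and \<epsilon>_nonneg: "\<And>k. 0 \<le> \<epsilon> k" and \<epsilon>_summable: "summable \<epsilon>"
    and step: "\<And>k. a (Suc k) \<le> (1 + \<gamma> k) * a k + \<epsilon> k"
  shows "convergent a"
proof -
  define P where "P n = (\<Prod>k<n. 1 + \<gamma> k)" for n
  define b where "b n = a n / P n" for n
  define c where "c n = b n - (\<Sum>k<n. \<epsilon> k)" for n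
  have P_ge_1: "1 \<le> P n" for n
    unfolding P_def by (intro prod_ge_1) (simp add: \<gamma>_nonneg)
  then have P_pos: "0 < P n" for n
    using less_le_trans zero_less_one by blast
  have P_Suc: "P (Suc n) = (1 + \<gamma> n) * P n" for n
    by (simp add: P_def mult.commute)
  have "convergent_prod (\<lambda>k. 1 + \<gamma> k)"
  proof (rule summable_imp_convergent_prod_real)
    show "summable (\<lambda>k. \<bar>\<gamma> k\<bar>)"
      using \<gamma>_summable \<gamma>_nonneg by simp
    show "\<gamma> k \<noteq> -1" for k
      using \<gamma>_nonneg[of k] by linarith
  qed
  then have "convergent (\<lambda>n. P (Suc n))"
    unfolding P_def lessThan_Suc_atMost by (rule convergent_prod_imp_convergent)
  then have P_convergent: "convergent P"
    by (simp add: convergent_Suc_iff)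
  have b_Suc: "b (Suc n) \<le> b n + \<epsilon> n" for n
  proof -
    have "b (Suc n) \<le> ((1 + \<gamma> n) * a n + \<epsilon> n) / P (Suc n)"
      unfolding b_def using step P_pos by (simp add: divide_right_mono less_imp_le)
    also have "\<dots> = b n + \<epsilon> n / P (Suc n)"
      using \<gamma>_nonneg[of n] by (simp add: P_Suc b_def add_divide_distrib)
    also have "\<epsilon> n / P (Suc n) \<le> \<epsilon> n"
      using P_ge_1[of "Suc n"] P_pos[of "Suc n"] mult_left_mono[OF P_ge_1[of "Suc n"] \<epsilon>_nonneg[of n]]
      by (simp add: divide_le_eq)
    finally show ?thesis by simp
  qed
  have "decseq c"
    by (rule decseq_SucI) (use b_Suc in \<open>simp add: c_def algebra_simps\<close>)
  moreover have "- suminf \<epsilon> \<le> c n" for n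
  proof -
    have "0 \<le> b n"
      using a_nonneg P_pos by (simp add: b_def less_imp_le)
    moreover have "(\<Sum>k<n. \<epsilon> k) \<le> suminf \<epsilon>"
      using \<epsilon>_summable \<epsilon>_nonneg by (intro sum_le_suminf) auto
    ultimately show ?thesis by (simp add: c_def)
  qed
  ultimately have "convergent c"
    by (metis convergentI decseq_convergent)
  then have "convergent (\<lambda>n. (c n + (\<Sum>k<n. \<epsilon> k)) * P n)"
    using \<epsilon>_summable P_convergent
    by (intro convergent_mult convergent_add) (auto simp: summable_iff_convergent)
  moreover have "a = (\<lambda>n. (c n + (\<Sum>k<n. \<epsilon> k)) * P n)"
    using P_pos by (simp add: c_def b_def less_imp_neq[THEN not_sym])
  ultimately show ?thesis by simp
qed

text \<open>
  Weak lower semicontinuity of the norm: testing the convergence against the limit \<open>l\<close> itself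
  gives \<open>norm l ^ 2 \<le> C * norm l\<close>.
\<close>

lemma norm_weak_limit_le:
  fixes l :: "'a::real_inner"
  assumes "weakly_converges_to X l" and bound: "\<And>n. norm (X n) \<le> C"
  shows "norm l \<le> C"
proof -
  have "(\<lambda>n. X n \<bullet> l) \<longlonglongrightarrow> l \<bullet> l"
    using assms(1) by (simp add: weakly_converges_to_def)
  moreover have "X n \<bullet> l \<le> C * norm l" for n
    using norm_cauchy_schwarz[of "X n" l] mult_right_mono[OF bound[of n] norm_ge_zero[of l]]
    by linarith
  ultimately have "l \<bullet> l \<le> C * norm l"
    by (intro LIMSEQ_le_const2) auto
  then have "norm l * norm l \<le> C * norm l"
    by (simp add: power2_norm_eq_inner flip: power2_eq_square)
  moreover have "0 \<le> C"
    using bound norm_ge_zero order_trans by blast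
  ultimately show ?thesis
    by (cases "l = 0") auto
qed

lemma weakly_converges_to_diff:
  assumes "weakly_converges_to X l" and "weakly_converges_to Y m"
  shows "weakly_converges_to (\<lambda>n. X n - Y n) (l - m)"
  using assms by (auto simp: weakly_converges_to_def inner_diff_left intro: tendsto_diff)

lemma weakly_converges_to_offset:
  "weakly_converges_to (\<lambda>n. X (n + i)) l \<Longrightarrow> weakly_converges_to X l"
  unfolding weakly_converges_to_def by (blast intro: LIMSEQ_offset)

text \<open>
  This is the Moore--Osgood theorem for the weak topology, with uniformity measured in norm. The
  strong convergence of \<open>l\<close>, although the rows \<open>X i\<close> converge only weakly, holds because
  the estimate \<open>norm (X i n - X j n) \<le> r i + r j\<close> survives the weak limit in \<open>n\<close>.
\<close>

lemma exchange_weak_limits: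
  fixes X :: "nat \<Rightarrow> nat \<Rightarrow> 'a::{real_inner, complete_space}"
  assumes close: "\<And>i n. norm (x n - X i n) \<le> r i" and "r \<longlonglongrightarrow> 0"
    and weak: "\<And>i. weakly_converges_to (X i) (l i)"
  obtains L where "l \<longlonglongrightarrow> L" and "weakly_converges_to x L"
    and "(\<And>i. X i \<longlonglongrightarrow> l i) \<Longrightarrow> x \<longlonglongrightarrow> L"
proof -
  have dist_l: "norm (l i - l j) \<le> r i + r j" for i j
  proof (rule norm_weak_limit_le)
    show "weakly_converges_to (\<lambda>n. X i n - X j n) (l i - l j)"
      by (intro weakly_converges_to_diff weak)
    show "norm (X i n - X j n) \<le> r i + r j" for n
      using norm_triangle_le_diff[of "x n - X j n" "x n - X i n" "r i + r j"]
        close[of n i] close[of n j] by simp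
  qed
  have "Cauchy l"
  proof (rule metric_CauchyI)
    fix \<eta> :: real
    assume "0 < \<eta>"
    then obtain N where N: "\<And>i. N \<le> i \<Longrightarrow> r i < \<eta> / 2"
      using order_tendstoD(2)[OF \<open>r \<longlonglongrightarrow> 0\<close>, of "\<eta> / 2"] by (auto simp: eventually_sequentially)
    have "dist (l i) (l j) < \<eta>" if "N \<le> i" "N \<le> j" for i j
      using dist_l[of i j] N[OF that(1)] N[OF that(2)] by (simp add: dist_norm)
    then show "\<exists>M. \<forall>i\<ge>M. \<forall>j\<ge>M. dist (l i) (l j) < \<eta>" by blast
  qed
  then obtain L where L: "l \<longlonglongrightarrow> L"
    using Cauchy_convergent convergentD by blast
  have uniform: "uniform_limit UNIV X x sequentially"
  proof (rule uniform_limitI)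
    fix \<eta> :: real
    assume "0 < \<eta>"
    then have "\<forall>\<^sub>F i in sequentially. r i < \<eta>"
      using \<open>r \<longlonglongrightarrow> 0\<close> by (simp add: order_tendstoD(2))
    then show "\<forall>\<^sub>F i in sequentially. \<forall>n\<in>UNIV. dist (X i n) (x n) < \<eta>"
      by eventually_elim (use close in \<open>auto simp: dist_norm norm_minus_commute intro: le_less_trans\<close>)
  qed
  have "weakly_converges_to x L"
    unfolding weakly_converges_to_def
  proof
    fix u
    show "(\<lambda>n. x n \<bullet> u) \<longlonglongrightarrow> L \<bullet> u"
    proof (rule swap_uniform_limit')
      show "\<forall>\<^sub>F i in sequentially. (\<lambda>n. X i n \<bullet> u) \<longlonglongrightarrow> l i \<bullet> u"
        using weak by (simp add: weakly_converges_to_def)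
      show "(\<lambda>i. l i \<bullet> u) \<longlonglongrightarrow> L \<bullet> u"
        using L by (intro tendsto_intros)
      show "uniform_limit UNIV (\<lambda>i n. X i n \<bullet> u) (\<lambda>n. x n \<bullet> u) sequentially"
        by (rule bounded_linear.uniform_limit[OF bounded_linear_inner_left uniform])
    qed simp_all
  qed
  moreover have "x \<longlonglongrightarrow> L" if "\<And>i. X i \<longlonglongrightarrow> l i"
    using that by (intro swap_uniform_limit'[OF _ L uniform]) simp_all
  ultimately show thesis
    using that L by blast
qed

text \<open>
  Each step adds its own error \<open>\<delta> (k + i)\<close> and, by nonexpansiveness, does not enlarge the
  distance accumulated before, so errors simply add up.
\<close>

lemma norm_diff_exact_iteration_le:
  assumes G_nonexpansive: "\<And>k. nonexpansive (G k)"
    and step: "\<And>k. norm (x (Suc k) - G k (x k)) \<le> \<delta> k"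
    and \<xi>_0: "\<xi> 0 = x i"
    and \<xi>_Suc: "\<And>k. \<xi> (Suc k) = G (k + i) (\<xi> k)"
  shows "norm (x (k + i) - \<xi> k) \<le> (\<Sum>j<k. \<delta> (j + i))"
proof (induction k)
  case 0
  then show ?case by (simp add: \<xi>_0)
next
  case (Suc k)
  have "norm (G (k + i) (x (k + i)) - G (k + i) (\<xi> k)) \<le> norm (x (k + i) - \<xi> k)"
    using G_nonexpansive by (simp add: nonexpansive_def)
  then have "norm (x (Suc (k + i)) - G (k + i) (\<xi> k)) \<le> \<delta> (k + i) + norm (x (k + i) - \<xi> k)"
    using step by (rule norm_diff_triangle_le[rotated])
  then show ?case using Suc by (simp add: \<xi>_Suc)
qed

lemma tendsto_suminf_tail:
  fixes f :: "nat \<Rightarrow> 'a::real_normed_vector"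
  assumes "summable f"
  shows "(\<lambda>i. \<Sum>j. f (j + i)) \<longlonglongrightarrow> 0"
proof -
  have "(\<lambda>i. suminf f - (\<Sum>j<i. f j)) \<longlonglongrightarrow> suminf f - suminf f"
    by (intro tendsto_diff tendsto_const summable_LIMSEQ assms)
  then show ?thesis
    using assms by (simp add: suminf_minus_initial_segment)
qed

theorem theorem3p2:
  fixes G F :: "nat \<Rightarrow> 'a::{real_inner, complete_space} \<Rightarrow> 'a"
    and e x :: "nat \<Rightarrow> 'a"
    and \<xi> :: "nat \<Rightarrow> nat \<Rightarrow> 'a"
  assumes G_nonexpansive: "\<And>k. nonexpansive (G k)"
    and e_summable: "summable (\<lambda>k. norm (e k))"
    and x_Suc: "\<And>k. x (Suc k) = F k (x k) + e k"
    and \<xi>_0: "\<And>i. \<xi> 0 i = x i"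
    and \<xi>_Suc: "\<And>k i. \<xi> (Suc k) i = G (k + i) (\<xi> k i)"
  shows
    "((\<Inter>k. Fix (G k)) \<noteq> {} \<longrightarrow>
        (\<forall>xbar \<in> (\<Inter>k. Fix (G k)). \<forall>\<gamma> :: nat \<Rightarrow> real.
          (\<forall>k. 0 \<le> \<gamma> k) \<and> summable \<gamma> \<and>
          summable (\<lambda>k. norm (F k xbar - G k xbar)) \<and>
          (\<forall>k. (1 + \<gamma> k)-lipschitz_on UNIV (F k)) \<longrightarrow>
            (\<exists>l \<ge> 0. (\<lambda>k. norm (x k - xbar)) \<longlonglongrightarrow> l) \<and> bounded (range x)))
     \<and>
     (\<forall>\<xi>lim :: nat \<Rightarrow> 'a.
        summable (\<lambda>k. norm (F k (x k) - G k (x k))) \<and>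
        (\<forall>i. weakly_converges_to (\<lambda>k. \<xi> k i) (\<xi>lim i)) \<longrightarrow>
          (\<exists>\<xi>bar. \<xi>lim \<longlonglongrightarrow> \<xi>bar \<and>
             weakly_converges_to x \<xi>bar \<and>
             ((\<forall>i. (\<lambda>k. \<xi> k i) \<longlonglongrightarrow> \<xi>lim i) \<longrightarrow> x \<longlonglongrightarrow> \<xi>bar)))"
proof (intro conjI impI ballI allI)
  fix xbar and \<gamma> :: "nat \<Rightarrow> real"
  assume fixed: "xbar \<in> (\<Inter>k. Fix (G k))"
    and asm: "(\<forall>k. 0 \<le> \<gamma> k) \<and> summable \<gamma> \<and>
          summable (\<lambda>k. norm (F k xbar - G k xbar)) \<and>
          (\<forall>k. (1 + \<gamma> k)-lipschitz_on UNIV (F k))"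
  have G_xbar: "G k xbar = xbar" for k
    using fixed by (auto simp: Fix_def)
  have "norm (x (Suc k) - xbar)
      \<le> (1 + \<gamma> k) * norm (x k - xbar) + (norm (F k xbar - G k xbar) + norm (e k))" for k
  proof -
    have "norm (x (Suc k) - xbar) = norm ((F k (x k) - F k xbar) + ((F k xbar - G k xbar) + e k))"
      by (simp add: x_Suc G_xbar algebra_simps)
    also have "\<dots> \<le> norm (F k (x k) - F k xbar) + (norm (F k xbar - G k xbar) + norm (e k))"
      by (intro norm_triangle_le add_left_mono norm_triangle_ineq)
    also have "norm (F k (x k) - F k xbar) \<le> (1 + \<gamma> k) * norm (x k - xbar)"
      using asm lipschitz_onD[of "1 + \<gamma> k" UNIV "F k" "x k" xbar] by (simp add: dist_norm)
    finally show ?thesis by simp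
  qed
  then have "convergent (\<lambda>k. norm (x k - xbar))"
    using asm e_summable
    by (intro convergent_of_summable_perturbation[where \<gamma> = \<gamma>
          and \<epsilon> = "\<lambda>k. norm (F k xbar - G k xbar) + norm (e k)"])
       (auto intro: summable_add)
  then obtain l where l: "(\<lambda>k. norm (x k - xbar)) \<longlonglongrightarrow> l"
    by (auto simp: convergent_def)
  moreover have "0 \<le> l"
    using l by (rule LIMSEQ_le_const) simp
  ultimately show "\<exists>l\<ge>0. (\<lambda>k. norm (x k - xbar)) \<longlonglongrightarrow> l" by blast
  obtain K where "\<And>k. norm (x k - xbar) \<le> K"
    using convergent_imp_Bseq[OF convergentI[OF l]] by (auto simp: Bseq_def)
  then have "\<forall>y\<in>range x. dist xbar y \<le> K"
    by (simp add: dist_norm norm_minus_commute)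
  then show "bounded (range x)"
    unfolding bounded_def by blast
next
  fix \<xi>lim :: "nat \<Rightarrow> 'a"
  assume asm: "summable (\<lambda>k. norm (F k (x k) - G k (x k))) \<and>
        (\<forall>i. weakly_converges_to (\<lambda>k. \<xi> k i) (\<xi>lim i))"
  define \<delta> where "\<delta> k = norm (F k (x k) - G k (x k)) + norm (e k)" for k
  have \<delta>_nonneg: "0 \<le> \<delta> k" for k
    by (simp add: \<delta>_def)
  have \<delta>_summable: "summable \<delta>"
    unfolding \<delta>_def using asm e_summable by (intro summable_add) auto
  have step: "norm (x (Suc k) - G k (x k)) \<le> \<delta> k" for k
    using norm_triangle_ineq[of "F k (x k) - G k (x k)" "e k"]
    by (simp add: x_Suc \<delta>_def algebra_simps)
  define r where "r i = (\<Sum>j. \<delta> (j + i))" for i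
  have \<xi>_close: "norm (x (k + i) - \<xi> k i) \<le> r i" for k i
  proof -
    have "norm (x (k + i) - \<xi> k i) \<le> (\<Sum>j<k. \<delta> (j + i))"
      by (rule norm_diff_exact_iteration_le[OF G_nonexpansive step \<xi>_0 \<xi>_Suc])
    also have "\<dots> \<le> r i"
      unfolding r_def using \<delta>_summable \<delta>_nonneg by (intro sum_le_suminf summable_ignore_initial_segment) auto
    finally show ?thesis .
  qed
  \<comment> \<open>\<open>X i\<close> follows the perturbed iteration up to time \<open>i\<close> and the exact one from then on. The
    initial piece makes the bound \<open>r i\<close> hold at all times, that is, uniformly.\<close>
  define X where "X i n = (if n < i then x n else \<xi> (n - i) i)" for i n
  have X_offset: "(\<lambda>n. X i (n + i)) = (\<lambda>n. \<xi> n i)" for i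
    by (simp add: X_def)
  have r_nonneg: "0 \<le> r i" for i
    using \<xi>_close[of 0 i] norm_ge_zero order_trans by blast
  have X_close: "norm (x n - X i n) \<le> r i" for i n
    using \<xi>_close[of "n - i" i] r_nonneg by (cases "n < i") (simp_all add: X_def)
  have r_lim: "r \<longlonglongrightarrow> 0"
    unfolding r_def using \<delta>_summable by (rule tendsto_suminf_tail)
  have X_weak: "weakly_converges_to (X i) (\<xi>lim i)" for i
    by (rule weakly_converges_to_offset[where i = i]) (use asm in \<open>simp add: X_offset\<close>)
  obtain \<xi>bar where "\<xi>lim \<longlonglongrightarrow> \<xi>bar" and "weakly_converges_to x \<xi>bar"
    and strong: "(\<And>i. X i \<longlonglongrightarrow> \<xi>lim i) \<Longrightarrow> x \<longlonglongrightarrow> \<xi>bar"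
    using exchange_weak_limits[OF X_close r_lim X_weak] by blast
  moreover have "x \<longlonglongrightarrow> \<xi>bar" if "\<forall>i. (\<lambda>k. \<xi> k i) \<longlonglongrightarrow> \<xi>lim i"
  proof (rule strong)
    fix i
    show "X i \<longlonglongrightarrow> \<xi>lim i"
      by (rule LIMSEQ_offset[where k = i]) (use that in \<open>simp add: X_offset\<close>)
  qed
  ultimately show "\<exists>\<xi>bar. \<xi>lim \<longlonglongrightarrow> \<xi>bar \<and> weakly_converges_to x \<xi>bar \<and>
      ((\<forall>i. (\<lambda>k. \<xi> k i) \<longlonglongrightarrow> \<xi>lim i) \<longrightarrow> x \<longlonglongrightarrow> \<xi>bar)"
    by blast
qed

end
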